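(* Let $S$ be an LA-semigroup with left identity. Then the following conditions are equivalent: (i) $S$ is intra-regular; (ii) $A=(SA)^{2}$ for every left ideal $A$ of $S$.
   Context: An LA-semigroup (left almost semigroup) is a nonempty set $S$ with a binary operation, written as juxtaposition, satisfying the left invertive law $(ab)c=(cb)a$ for all $a,b,c\in S$ (associativity and commutativity are not assumed). A left identity is an element $e\in S$ with $ea=a$ for all $a\in S$. For subsets $A,B\subseteq S$, $AB=\{ab: a\in A,\ b\in B\}$ and $A^2=AA$. A nonempty subset $A\subseteq S$ is a left ideal if $SA\subseteq A$. $S$ is intra-regular if for every $a\in S$ there exist $x,y\in S$ such that $a=(xa^{2})y$, where $a^2=aa$. *)

theory Defs
  imports Main
begin

locale la_semigroup =
  fixes S :: "'a set"
    and mult :: "'a \<Rightarrow> 'a \<Rightarrow> 'a"  (infixl "\<cdot>" 70)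
  assumes nonempty: "S \<noteq> {}"
    and closed: "\<lbrakk>a \<in> S; b \<in> S\<rbrakk> \<Longrightarrow> a \<cdot> b \<in> S"
    and left_invertive: "\<lbrakk>a \<in> S; b \<in> S; c \<in> S\<rbrakk> \<Longrightarrow> (a \<cdot> b) \<cdot> c = (c \<cdot> b) \<cdot> a"

definition left_identity :: "'a set \<Rightarrow> ('a \<Rightarrow> 'a \<Rightarrow> 'a) \<Rightarrow> 'a \<Rightarrow> bool" where
  "left_identity S mult e \<longleftrightarrow> e \<in> S \<and> (\<forall>a\<in>S. mult e a = a)"

definition set_mult :: "('a \<Rightarrow> 'a \<Rightarrow> 'a) \<Rightarrow> 'a set \<Rightarrow> 'a set \<Rightarrow> 'a set" where
  "set_mult mult A B = {mult a b | a b. a \<in> A \<and> b \<in> B}"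

definition set_square :: "('a \<Rightarrow> 'a \<Rightarrow> 'a) \<Rightarrow> 'a set \<Rightarrow> 'a set" where
  "set_square mult A = set_mult mult A A"

definition left_ideal :: "'a set \<Rightarrow> ('a \<Rightarrow> 'a \<Rightarrow> 'a) \<Rightarrow> 'a set \<Rightarrow> bool" where
  "left_ideal S mult A \<longleftrightarrow> A \<noteq> {} \<and> A \<subseteq> S \<and> set_mult mult S A \<subseteq> A"

definition intra_regular :: "'a set \<Rightarrow> ('a \<Rightarrow> 'a \<Rightarrow> 'a) \<Rightarrow> bool" where
  "intra_regular S mult \<longleftrightarrow>
     (\<forall>a\<in>S. \<exists>x\<in>S. \<exists>y\<in>S. a = mult (mult x (mult a a)) y)"

end

theory Submission
  imports Defs
begin

text \<open>
  A left identity \<open>e\<close> gives \<open>A = eA \<subseteq> SA \<subseteq> A\<close>, so \<open>SA = A\<close> for every left ideal \<open>A\<close>, and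
  the second condition says that every left ideal is idempotent: \<open>A = AA\<close>. The rest is
  rearranging products by three laws that stand in for associativity and commutativity,
  \<open>(ab)(cd) = (ac)(bd)\<close>, \<open>a(bc) = b(ac)\<close> and \<open>(ab)(cd) = (db)(ca)\<close>; the last two rely on the
  left identity.

  If \<open>a = (xa\<^sup>2)y\<close>, then \<open>a = (a(xa))y = (y(xa))a\<close>, and both factors lie in any left ideal
  that contains \<open>a\<close>. Conversely, \<open>Sa\<close> is a left ideal that contains \<open>a = ea\<close>. Its idempotence
  gives \<open>a = (xa)(ya)\<close>, and the third law collects the two copies of \<open>a\<close> in front:
  \<open>a = a\<^sup>2(yx) = (ea\<^sup>2)(yx)\<close>.
\<close>

context la_semigroup
begin

lemma medial:
  assumes "a \<in> S" "b \<in> S" "c \<in> S" "d \<in> S"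
  shows "(a \<cdot> b) \<cdot> (c \<cdot> d) = (a \<cdot> c) \<cdot> (b \<cdot> d)"
proof -
  have "(a \<cdot> b) \<cdot> (c \<cdot> d) = ((c \<cdot> d) \<cdot> b) \<cdot> a"
    using assms by (intro left_invertive closed)
  also have "(c \<cdot> d) \<cdot> b = (b \<cdot> d) \<cdot> c"
    using assms by (intro left_invertive)
  also have "((b \<cdot> d) \<cdot> c) \<cdot> a = (a \<cdot> c) \<cdot> (b \<cdot> d)"
    using assms by (intro left_invertive closed)
  finally show ?thesis .
qed

text \<open>The medial law for the product \<open>(ea)(bc)\<close>.\<close>

lemma left_commute:
  assumes "left_identity S mult e" "a \<in> S" "b \<in> S" "c \<in> S"
  shows "a \<cdot> (b \<cdot> c) = b \<cdot> (a \<cdot> c)"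
  using medial[of e a b c] assms by (simp add: left_identity_def)

lemma paramedial:
  assumes "left_identity S mult e" "a \<in> S" "b \<in> S" "c \<in> S" "d \<in> S"
  shows "(a \<cdot> b) \<cdot> (c \<cdot> d) = (d \<cdot> b) \<cdot> (c \<cdot> a)"
proof -
  have "(a \<cdot> b) \<cdot> (c \<cdot> d) = c \<cdot> ((a \<cdot> b) \<cdot> d)"
    using assms by (intro left_commute[of e]) (auto intro: closed)
  also have "(a \<cdot> b) \<cdot> d = (d \<cdot> b) \<cdot> a"
    using assms by (intro left_invertive)
  also have "c \<cdot> ((d \<cdot> b) \<cdot> a) = (d \<cdot> b) \<cdot> (c \<cdot> a)"
    using assms by (intro left_commute[of e]) (auto intro: closed)
  finally show ?thesis .
qed

lemma set_mult_left_ideal: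
  assumes "left_identity S mult e" "left_ideal S mult A"
  shows "set_mult mult S A = A"
proof
  show "set_mult mult S A \<subseteq> A"
    using assms(2) by (simp add: left_ideal_def)
  show "A \<subseteq> set_mult mult S A"
  proof
    fix a assume "a \<in> A"
    moreover from this have "e \<in> S" "a = e \<cdot> a"
      using assms by (auto simp: left_identity_def left_ideal_def)
    ultimately show "a \<in> set_mult mult S A"
      unfolding set_mult_def by blast
  qed
qed

text \<open>
  Without associativity, closure of \<open>Sa\<close> under left multiplication is not automatic; it comes
  from \<open>x(ya) = (ex)(ya) = (ax)(ye) = ((ye)x)a\<close>.
\<close>

lemma left_ideal_principal:
  assumes e: "left_identity S mult e" and a: "a \<in> S"
  shows "left_ideal S mult (set_mult mult S {a})"
proof -
  have eS: "e \<in> S" using e by (simp add: left_identity_def)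
  have absorb: "x \<cdot> (y \<cdot> a) = ((y \<cdot> e) \<cdot> x) \<cdot> a" if "x \<in> S" "y \<in> S" for x y
  proof -
    have "x \<cdot> (y \<cdot> a) = (e \<cdot> x) \<cdot> (y \<cdot> a)"
      using e that by (simp add: left_identity_def)
    also have "\<dots> = (a \<cdot> x) \<cdot> (y \<cdot> e)"
      using e eS a that by (intro paramedial)
    also have "\<dots> = ((y \<cdot> e) \<cdot> x) \<cdot> a"
      using eS a that by (intro left_invertive closed)
    finally show ?thesis .
  qed
  have "x \<cdot> (y \<cdot> a) \<in> set_mult mult S {a}" if "x \<in> S" "y \<in> S" for x y
  proof -
    have "(y \<cdot> e) \<cdot> x \<in> S" using that eS by (simp add: closed)
    then show ?thesis using absorb[OF that] unfolding set_mult_def by blast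
  qed
  then have "set_mult mult S (set_mult mult S {a}) \<subseteq> set_mult mult S {a}"
    unfolding set_mult_def[of mult S "set_mult mult S {a}"]
    by (auto simp: set_mult_def[of mult S "{a}"])
  moreover have "set_mult mult S {a} \<noteq> {}" "set_mult mult S {a} \<subseteq> S"
    using nonempty a by (auto simp: set_mult_def closed)
  ultimately show ?thesis by (simp add: left_ideal_def)
qed

lemma intra_regular_imp_idempotent:
  assumes e: "left_identity S mult e" and reg: "intra_regular S mult"
    and A: "left_ideal S mult A"
  shows "set_square mult A = A"
proof
  have absorb: "s \<cdot> a \<in> A" if "s \<in> S" "a \<in> A" for s a
    using A that by (auto simp: left_ideal_def set_mult_def)
  have sub: "A \<subseteq> S" using A by (simp add: left_ideal_def)
  show "set_square mult A \<subseteq> A"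
    using absorb sub by (auto simp: set_square_def set_mult_def)
  show "A \<subseteq> set_square mult A"
  proof
    fix a assume a: "a \<in> A"
    then have aS: "a \<in> S" using sub by blast
    then obtain x y where x: "x \<in> S" and y: "y \<in> S" and eq: "a = (x \<cdot> (a \<cdot> a)) \<cdot> y"
      using reg unfolding intra_regular_def by blast
    note eq
    also have "x \<cdot> (a \<cdot> a) = a \<cdot> (x \<cdot> a)"
      using e x aS aS by (rule left_commute)
    also have "(a \<cdot> (x \<cdot> a)) \<cdot> y = (y \<cdot> (x \<cdot> a)) \<cdot> a"
      using x y aS by (intro left_invertive closed)
    finally have "a = (y \<cdot> (x \<cdot> a)) \<cdot> a" .
    moreover have "y \<cdot> (x \<cdot> a) \<in> A" using absorb x y a by blast
    ultimately show "a \<in> set_square mult A"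
      using a unfolding set_square_def set_mult_def by blast
  qed
qed

text \<open>Only the principal left ideals \<open>Sa\<close> matter for this direction.\<close>

lemma idempotent_imp_intra_regular:
  assumes e: "left_identity S mult e"
    and idem: "\<And>a. a \<in> S \<Longrightarrow>
      set_square mult (set_mult mult S {a}) = set_mult mult S {a}"
  shows "intra_regular S mult"
  unfolding intra_regular_def
proof
  fix a assume a: "a \<in> S"
  have eS: "e \<in> S" and e_left: "\<And>b. b \<in> S \<Longrightarrow> e \<cdot> b = b"
    using e by (auto simp: left_identity_def)
  have "e \<cdot> a \<in> set_mult mult S {a}"
    using eS unfolding set_mult_def by blast
  then have "a \<in> set_square mult (set_mult mult S {a})"
    using a by (simp add: idem e_left)
  then obtain x y where x: "x \<in> S" and y: "y \<in> S" and eq: "a = (x \<cdot> a) \<cdot> (y \<cdot> a)"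
    by (auto simp: set_square_def set_mult_def)
  note eq
  also have "(x \<cdot> a) \<cdot> (y \<cdot> a) = (a \<cdot> a) \<cdot> (y \<cdot> x)"
    using e x a y a by (rule paramedial)
  also have "\<dots> = (e \<cdot> (a \<cdot> a)) \<cdot> (y \<cdot> x)"
    using a by (simp add: e_left closed)
  finally show "\<exists>x\<in>S. \<exists>y\<in>S. a = (x \<cdot> (a \<cdot> a)) \<cdot> y"
    using eS closed[OF y x] by blast
qed

end

theorem theorem7:
  fixes S :: "'a set" and mult :: "'a \<Rightarrow> 'a \<Rightarrow> 'a"
  assumes "la_semigroup S mult"
    and "\<exists>e. left_identity S mult e"
  shows "intra_regular S mult \<longleftrightarrow>
    (\<forall>A. left_ideal S mult A \<longrightarrow> A = set_square mult (set_mult mult S A))"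
proof -
  interpret la_semigroup S mult by (fact assms(1))
  obtain e where e: "left_identity S mult e" using assms(2) by blast
  show ?thesis
  proof
    assume "intra_regular S mult"
    then show "\<forall>A. left_ideal S mult A \<longrightarrow> A = set_square mult (set_mult mult S A)"
      using intra_regular_imp_idempotent[OF e] by (simp add: set_mult_left_ideal[OF e])
  next
    assume *: "\<forall>A. left_ideal S mult A \<longrightarrow> A = set_square mult (set_mult mult S A)"
    show "intra_regular S mult"
    proof (rule idempotent_imp_intra_regular[OF e])
      fix a assume "a \<in> S"
      then have "left_ideal S mult (set_mult mult S {a})"
        by (rule left_ideal_principal[OF e])
      then show "set_square mult (set_mult mult S {a}) = set_mult mult S {a}"
        using *[rule_format, of "set_mult mult S {a}"] by (simp only: set_mult_left_ideal[OF e])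
    qed
  qed
qed

end
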